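(* Let $u\in C_{+,1/2}$ be (log, $x^2$)-convex. Then the Legendre transform of the dual Legendre function $u^*$ is given by $$\ell_{u^*}(t)=\frac{e^{2t}}{\ell_u(t)\,t^{2t}}\qquad\text{for all } t\ge 0.$$
   Context: $C_{+,\log}$ denotes the set of all positive continuous functions $u:[0,\infty)\to(0,\infty)$ with $\lim_{r\to\infty}\frac{\log u(r)}{\log r}=\infty$, and $C_{+,1/2}$ the set of all positive continuous functions $u$ on $[0,\infty)$ with $\lim_{r\to\infty}\frac{\log u(r)}{\sqrt r}=\infty$; thus $C_{+,1/2}\subset C_{+,\log}$. For $u\in C_{+,\log}$ the Legendre transform is $\ell_u(t)=\inf_{r>0}\frac{u(r)}{r^t}$, $t\in[0,\infty)$. For $u\in C_{+,1/2}$ the dual Legendre function is $u^*(r)=\sup_{s>0}\frac{e^{2\sqrt{rs}}}{u(s)}$, $r\ge0$ (it again belongs to $C_{+,1/2}$, so $\ell_{u^*}$ is defined). A positive continuous function $u$ on $[0,\infty)$ is (log, $x^2$)-convex if $x\mapsto\log u(x^2)$ is convex on $[0,\infty)$. Convention: $0^0=1$. *)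

theory Defs
  imports "HOL-Analysis.Analysis"
begin

text \<open>Functions on the half-line are total functions of type \<^typ>\<open>real \<Rightarrow> real\<close>; only their
  values on \<open>[0, \<infinity>)\<close> are ever constrained or used.\<close>

definition C_pos :: "(real \<Rightarrow> real) set" where
  "C_pos = {u. continuous_on {0..} u \<and> (\<forall>r\<ge>0. u r > 0)}"

definition C_log :: "(real \<Rightarrow> real) set" where
  "C_log = {u \<in> C_pos. filterlim (\<lambda>r. ln (u r) / ln r) at_top at_top}"

definition C_half :: "(real \<Rightarrow> real) set" where
  "C_half = {u \<in> C_pos. filterlim (\<lambda>r. ln (u r) / sqrt r) at_top at_top}"

text \<open>The infimum is over a nonempty set of positive reals whenever \<open>u\<close> is positive on
  \<open>(0, \<infinity>)\<close>, so it is a genuine infimum. It is intended for \<open>u \<in> C_log\<close> and \<open>t \<ge> 0\<close>.\<close>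

definition legendre :: "(real \<Rightarrow> real) \<Rightarrow> real \<Rightarrow> real" where
  "legendre u t = (INF r\<in>{0<..}. u r / r powr t)"

text \<open>For \<open>u \<in> C_half\<close> and \<open>r \<ge> 0\<close> the growth of \<open>u\<close> makes the set bounded above (it is
  nonempty in any case), so the supremum in the reals is the genuine one.\<close>

definition dual_legendre :: "(real \<Rightarrow> real) \<Rightarrow> real \<Rightarrow> real" where
  "dual_legendre u r = (SUP s\<in>{0<..}. exp (2 * sqrt (r * s)) / u s)"

definition log_x2_convex :: "(real \<Rightarrow> real) \<Rightarrow> bool" where
  "log_x2_convex u \<longleftrightarrow> u \<in> C_pos \<and> convex_on {0..} (\<lambda>x. ln (u (x\<^sup>2)))"

text \<open>Real power with \<open>0\<^sup>0 = 1\<close>; the library has \<open>0 powr 0 = 0\<close>.\<close>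

definition rpow :: "real \<Rightarrow> real \<Rightarrow> real" where
  "rpow x a = (if x = 0 \<and> a = 0 then 1 else x powr a)"

end

theory Submission
  imports Defs
begin

text \<open>
  Substitute \<open>r = x\<^sup>2\<close> and write \<open>f x = ln (u (x\<^sup>2))\<close>. Then
  \<open>ln (u\<^sup>* (y\<^sup>2)) = sup\<^sub>x (2 x y - f x)\<close> is the convex conjugate of \<open>f\<close> at \<open>2 y\<close>, and
  the logarithm of the Legendre transform of \<open>u\<close> at \<open>t\<close> is \<open>inf\<^sub>x (f x - 2 t ln x)\<close>. The growth of
  \<open>u\<close> makes \<open>f\<close> superlinear (\<open>ln_sq_superlinear\<close>), which keeps all these quantities finite.

  Let \<open>t > 0\<close>. The function \<open>f x - 2 t ln x\<close> tends to infinity at both ends of \<open>(0, \<infinity>)\<close>, so it has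
  a minimiser \<open>p\<close> (\<open>exists_legendre_minimiser\<close>). Where \<open>f\<close> is differentiable, the minimum condition
  reads \<open>f' p = 2 t / p\<close>; convexity turns this, without any differentiability, into the statement
  that the line of slope \<open>2 t / p\<close> through \<open>(p, f p)\<close> supports \<open>f\<close> from below
  (\<open>supporting_line_at_minimiser\<close>). Hence at \<open>q = t / p\<close> the supremum defining \<open>u\<^sup>*\<close> is attained
  at \<open>p\<close>, so that \<open>ln (u\<^sup>* (q\<^sup>2)) = 2 t - f p\<close>. Finally \<open>q\<close> is where the infimum defining
  the Legendre transform of \<open>u\<^sup>*\<close> is attained: for all \<open>y\<close> one has
  \<open>ln (u\<^sup>* (y\<^sup>2)) - 2 t ln y \<ge> 2 p y - f p - 2 t ln y\<close>, and the right-hand side is smallest at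
  \<open>y = t / p\<close>. Both transforms being explicit in terms of \<open>p\<close>, the formula follows.

  For \<open>t = 0\<close> there may be no minimiser in \<open>(0, \<infinity>)\<close>, and the infimum of \<open>u\<^sup>*\<close> may be approached
  only as \<open>y \<rightarrow> 0\<close>. There the claim says that the infimum of \<open>u\<^sup>*\<close> is the supremum of \<open>1 / u\<close>, which
  follows from superlinearity (\<open>legendre_dual_zero\<close>).
\<close>

section \<open>Quadratic substitution\<close>

lemma square_image_pos: "(\<lambda>x::real. x\<^sup>2) ` {0<..} = {0<..}"
proof
  show "{0<..} \<subseteq> (\<lambda>x::real. x\<^sup>2) ` {0<..}"
  proof
    fix r :: real assume "r \<in> {0<..}"
    then show "r \<in> (\<lambda>x. x\<^sup>2) ` {0<..}"
      by (intro image_eqI[where x = "sqrt r"]) auto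
  qed
qed auto

lemma legendre_square:
  "legendre u t = (INF x\<in>{0<..}. u (x\<^sup>2) / x powr (2 * t))"
proof -
  have "legendre u t = (INF x\<in>{0<..}. u (x\<^sup>2) / (x\<^sup>2) powr t)"
    unfolding legendre_def by (subst square_image_pos[symmetric]) (simp add: image_image)
  also have "\<dots> = (INF x\<in>{0<..}. u (x\<^sup>2) / x powr (2 * t))"
  proof (rule INF_cong)
    fix x :: real assume "x \<in> {0<..}"
    then have "(x\<^sup>2) powr t = x powr (2 * t)"
      by (simp add: powr_powr flip: powr_numeral)
    then show "u (x\<^sup>2) / (x\<^sup>2) powr t = u (x\<^sup>2) / x powr (2 * t)" by simp
  qed simp
  finally show ?thesis .
qed

lemma dual_legendre_square:
  assumes "y \<ge> 0"
  shows "dual_legendre u (y\<^sup>2) = (SUP x\<in>{0<..}. exp (2 * x * y) / u (x\<^sup>2))"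
proof -
  have "dual_legendre u (y\<^sup>2) = (SUP x\<in>{0<..}. exp (2 * sqrt (y\<^sup>2 * x\<^sup>2)) / u (x\<^sup>2))"
    unfolding dual_legendre_def by (subst square_image_pos[symmetric]) (simp add: image_image)
  also have "\<dots> = (SUP x\<in>{0<..}. exp (2 * x * y) / u (x\<^sup>2))"
    using assms by (intro SUP_cong) (auto simp: real_sqrt_mult mult_ac)
  finally show ?thesis .
qed

section \<open>Superlinear growth\<close>

lemma C_half_posD: "u \<in> C_half \<Longrightarrow> r \<ge> 0 \<Longrightarrow> u r > 0"
  by (simp add: C_half_def C_pos_def)

lemma continuous_on_ln_sq:
  assumes "u \<in> C_half"
  shows "continuous_on {0..} (\<lambda>x. ln (u (x\<^sup>2)))"
proof -
  have "continuous_on {0..} u"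
    using assms by (simp add: C_half_def C_pos_def)
  moreover have "continuous_on {0..} (\<lambda>x::real. x\<^sup>2)"
    by (intro continuous_intros)
  ultimately have "continuous_on {0..} (\<lambda>x. u (x\<^sup>2))"
    by (rule continuous_on_compose2) auto
  moreover have "u (x\<^sup>2) \<noteq> 0" for x
    using C_half_posD[OF assms, of "x\<^sup>2"] by simp
  ultimately show ?thesis
    by (simp add: continuous_on_ln)
qed

text \<open>Far out, a slope of \<open>K\<close> is beaten because \<open>ln (u (x\<^sup>2)) / x\<close> tends to infinity; on the
  remaining compact interval the constant \<open>c\<close> absorbs the difference.\<close>

lemma ln_sq_superlinear:
  assumes "u \<in> C_half"
  obtains c where "\<And>x. x \<ge> 0 \<Longrightarrow> K * x - c \<le> ln (u (x\<^sup>2))"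
proof -
  have "filterlim (\<lambda>r. ln (u r) / sqrt r) at_top at_top"
    using assms by (simp add: C_half_def)
  then have "eventually (\<lambda>r. K \<le> ln (u r) / sqrt r) at_top"
    by (simp add: filterlim_at_top)
  then obtain R where R: "\<And>r. r \<ge> R \<Longrightarrow> K \<le> ln (u r) / sqrt r"
    by (auto simp: eventually_at_top_linorder)
  define X where "X = max 1 R"
  have far: "K * x \<le> ln (u (x\<^sup>2))" if "x \<ge> X" for x
  proof -
    have "x \<ge> 1" "x \<ge> R" using that by (auto simp: X_def)
    moreover from \<open>x \<ge> 1\<close> have "x\<^sup>2 \<ge> x" by (simp add: power2_eq_square)
    ultimately have "K \<le> ln (u (x\<^sup>2)) / x" using R[of "x\<^sup>2"] by simp
    then show ?thesis using \<open>x \<ge> 1\<close> by (simp add: field_simps)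
  qed
  have "continuous_on {0..X} (\<lambda>x. ln (u (x\<^sup>2)) - K * x)"
    by (intro continuous_intros continuous_on_subset[OF continuous_on_ln_sq[OF assms]]) auto
  then obtain p where p: "\<And>x. x \<in> {0..X} \<Longrightarrow> ln (u (p\<^sup>2)) - K * p \<le> ln (u (x\<^sup>2)) - K * x"
    using continuous_attains_inf[of "{0..X}" "\<lambda>x. ln (u (x\<^sup>2)) - K * x"]
    by (force simp: X_def)
  show thesis
  proof (rule that[of "max 0 (K * p - ln (u (p\<^sup>2)))"])
    fix x :: real assume "x \<ge> 0"
    then show "K * x - max 0 (K * p - ln (u (p\<^sup>2))) \<le> ln (u (x\<^sup>2))"
      using far[of x] p[of x] by (cases "x \<ge> X") auto
  qed
qed

lemma exp_div_eq_exp_diff_ln: "a > 0 \<Longrightarrow> exp b / a = exp (b - ln a)" for a b :: real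
  by (simp add: exp_diff)

lemma bdd_above_dual_legendre:
  assumes "u \<in> C_half"
  shows "bdd_above ((\<lambda>x. exp (2 * x * y) / u (x\<^sup>2)) ` {0<..})"
proof -
  obtain c where c: "\<And>x. x \<ge> 0 \<Longrightarrow> (2 * y) * x - c \<le> ln (u (x\<^sup>2))"
    using ln_sq_superlinear[OF assms] by blast
  show ?thesis
  proof (rule bdd_aboveI2[where M = "exp c"])
    fix x :: real assume "x \<in> {0<..}"
    then show "exp (2 * x * y) / u (x\<^sup>2) \<le> exp c"
      using c[of x] C_half_posD[OF assms, of "x\<^sup>2"]
      by (simp add: exp_div_eq_exp_diff_ln mult_ac)
  qed
qed

lemma dual_legendre_lower:
  assumes "u \<in> C_half" "x > 0" "y \<ge> 0"
  shows "exp (2 * x * y) / u (x\<^sup>2) \<le> dual_legendre u (y\<^sup>2)"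
proof -
  have "x \<in> {0<..}" using assms(2) by simp
  then show ?thesis
    unfolding dual_legendre_square[OF assms(3)]
    by (rule cSUP_upper[OF _ bdd_above_dual_legendre[OF assms(1)]])
qed

section \<open>The case of positive exponent\<close>

lemma exists_legendre_minimiser:
  assumes "u \<in> C_half" "t > 0"
  obtains p where "p > 0"
    and "\<And>x. x > 0 \<Longrightarrow> ln (u (p\<^sup>2)) - 2 * t * ln p \<le> ln (u (x\<^sup>2)) - 2 * t * ln x"
proof -
  define g where "g = (\<lambda>x. ln (u (x\<^sup>2)) - 2 * t * ln x)"
  obtain c where c: "\<And>x. x \<ge> 0 \<Longrightarrow> 0 * x - c \<le> ln (u (x\<^sup>2))"
    using ln_sq_superlinear[OF assms(1)] by blast
  obtain d where d: "\<And>x. x \<ge> 0 \<Longrightarrow> (2 * t + 1) * x - d \<le> ln (u (x\<^sup>2))"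
    using ln_sq_superlinear[OF assms(1)] by blast
  \<comment> \<open>Left of \<open>a\<close> the term \<open>- 2 t ln x\<close> alone lifts \<open>g\<close> above \<open>g 1\<close>; right of \<open>b\<close> the slope
    \<open>2 t + 1\<close> of the lower bound does, since \<open>ln x \<le> x\<close>.\<close>
  define a where "a = min 1 (exp (- (g 1 + c) / (2 * t)))"
  define b where "b = max 1 (g 1 + d)"
  have ab: "0 < a" "a \<le> 1" "1 \<le> b" by (auto simp: a_def b_def)
  have left: "g 1 \<le> g x" if "0 < x" "x < a" for x
  proof -
    have "ln x \<le> - (g 1 + c) / (2 * t)"
      using that by (metis a_def ln_less_cancel_iff ln_exp less_imp_le exp_gt_zero min_less_iff_conj)
    then have "2 * t * ln x \<le> - (g 1 + c)" using assms(2) by (simp add: field_simps)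
    moreover have "g x \<ge> - c - 2 * t * ln x" using c[of x] that by (simp add: g_def)
    ultimately show ?thesis by linarith
  qed
  have right: "g 1 \<le> g x" if "b < x" for x
  proof -
    have x: "x > 0" "x > g 1 + d" using that by (auto simp: b_def)
    have "2 * t * ln x \<le> 2 * t * x"
      using x assms(2) ln_le_minus_one[of x] by (intro mult_left_mono) auto
    then have "g x \<ge> x - d" using d[of x] x by (simp add: g_def algebra_simps)
    then show ?thesis using x by linarith
  qed
  have "continuous_on {a..b} g"
    unfolding g_def using ab
    by (intro continuous_intros continuous_on_subset[OF continuous_on_ln_sq[OF assms(1)]]) auto
  then obtain p where p: "p \<in> {a..b}" "\<And>x. x \<in> {a..b} \<Longrightarrow> g p \<le> g x"
    using continuous_attains_inf[of "{a..b}" g] ab by auto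
  show thesis
  proof (rule that[of p])
    show "p > 0" using p ab by auto
    fix x :: real assume "x > 0"
    have "g p \<le> g 1" using p(2)[of 1] ab by auto
    then have "g p \<le> g x"
      using left[of x] right[of x] p(2)[of x] \<open>x > 0\<close> by fastforce
    then show "ln (u (p\<^sup>2)) - 2 * t * ln p \<le> ln (u (x\<^sup>2)) - 2 * t * ln x"
      by (simp add: g_def)
  qed
qed

text \<open>The minimum condition gives \<open>f z \<ge> f p + k (ln z - ln p)\<close>. At \<open>z = p + h (x - p)\<close>, convexity
  bounds \<open>f z - f p\<close> above by \<open>h (f x - f p)\<close>; dividing by \<open>h\<close> and letting \<open>h \<rightarrow> 0\<close> turns the
  logarithm into its derivative \<open>1 / p\<close>.\<close>

lemma supporting_line_at_minimiser:
  fixes f :: "real \<Rightarrow> real"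
  assumes convex: "convex_on {0..} f" and "p > 0" "x \<ge> 0"
    and min: "\<And>z. z > 0 \<Longrightarrow> f p - k * ln p \<le> f z - k * ln z"
  shows "f p + k / p * (x - p) \<le> f x"
proof -
  define \<phi> where "\<phi> = (\<lambda>h. k * ln (p + h * (x - p)))"
  have "(\<phi> has_real_derivative k / p * (x - p)) (at 0)"
    unfolding \<phi>_def using \<open>p > 0\<close> by (auto intro!: derivative_eq_intros)
  then have "((\<lambda>h. (\<phi> h - \<phi> 0) / h) \<longlongrightarrow> k / p * (x - p)) (at_right 0)"
    unfolding has_field_derivative_iff diff_zero by (rule filterlim_mono[OF _ order_refl at_le]) simp_all
  moreover have "eventually (\<lambda>h. (\<phi> h - \<phi> 0) / h \<le> f x - f p) (at_right 0)"
  proof -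
    have "eventually (\<lambda>h::real. h \<in> {0<..<1}) (at_right 0)"
      by (rule eventually_at_right_real) simp
    then show ?thesis
    proof (rule eventually_mono)
      fix h :: real assume h: "h \<in> {0<..<1}"
      let ?z = "(1 - h) * p + h * x"
      have "?z > 0" using h assms by (intro add_pos_nonneg) auto
      have "f ?z \<le> (1 - h) * f p + h * f x"
        using convex_onD[OF convex, of h p x] h assms by simp
      with min[OF \<open>?z > 0\<close>] have "k * ln ?z - k * ln p \<le> h * (f x - f p)"
        by (simp add: algebra_simps)
      moreover have "?z = p + h * (x - p)" by (simp add: algebra_simps)
      ultimately have "\<phi> h - \<phi> 0 \<le> h * (f x - f p)" by (simp add: \<phi>_def)
      then show "(\<phi> h - \<phi> 0) / h \<le> f x - f p" using h by (simp add: field_simps)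
    qed
  qed
  ultimately have "k / p * (x - p) \<le> f x - f p"
    by (intro tendsto_upperbound) auto
  then show ?thesis by simp
qed

lemma legendre_dual_pos:
  assumes u: "u \<in> C_half" and convex: "convex_on {0..} (\<lambda>x. ln (u (x\<^sup>2)))" and "t > 0"
  shows "legendre (dual_legendre u) t = exp (2 * t) / (legendre u t * t powr (2 * t))"
proof -
  define f where "f = (\<lambda>x. ln (u (x\<^sup>2)))"
  have u_f: "u (x\<^sup>2) = exp (f x)" for x
    using C_half_posD[OF u, of "x\<^sup>2"] by (simp add: f_def)
  obtain p where p: "p > 0" and min: "\<And>x. x > 0 \<Longrightarrow> f p - 2 * t * ln p \<le> f x - 2 * t * ln x"
    unfolding f_def using exists_legendre_minimiser[OF u \<open>t > 0\<close>] by blast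
  define q where "q = t / p"
  have q: "q > 0" "p * q = t" using p \<open>t > 0\<close> by (auto simp: q_def)

  have val_u: "legendre u t = exp (f p - 2 * t * ln p)"
    unfolding legendre_square
  proof (rule cInf_eq_minimum)
    show "exp (f p - 2 * t * ln p) \<in> (\<lambda>x. u (x\<^sup>2) / x powr (2 * t)) ` {0<..}"
      using p by (intro image_eqI[where x = p]) (auto simp: u_f powr_def exp_diff)
    fix v assume "v \<in> (\<lambda>x. u (x\<^sup>2) / x powr (2 * t)) ` {0<..}"
    then obtain x where "x > 0" "v = exp (f x - 2 * t * ln x)"
      by (auto simp: u_f powr_def exp_diff)
    then show "exp (f p - 2 * t * ln p) \<le> v" using min by simp
  qed

  have dual_q: "dual_legendre u (q\<^sup>2) = exp (2 * t - f p)"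
    unfolding dual_legendre_square[OF less_imp_le[OF q(1)]]
  proof (rule cSup_eq_maximum)
    show "exp (2 * t - f p) \<in> (\<lambda>x. exp (2 * x * q) / u (x\<^sup>2)) ` {0<..}"
      using p q(2) by (intro image_eqI[where x = p]) (auto simp: u_f exp_diff mult.assoc)
    fix v assume "v \<in> (\<lambda>x. exp (2 * x * q) / u (x\<^sup>2)) ` {0<..}"
    then obtain x where x: "x > 0" "v = exp (2 * x * q - f x)"
      by (auto simp: u_f exp_diff)
    have "f p + 2 * t / p * (x - p) \<le> f x"
      using convex p x min by (intro supporting_line_at_minimiser) (auto simp: f_def)
    moreover have "2 * t / p * (x - p) = 2 * x * q - 2 * t"
      using p by (simp add: q_def field_simps)
    ultimately show "v \<le> exp (2 * t - f p)" using x by simp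
  qed

  have "legendre (dual_legendre u) t = exp (2 * t - f p - 2 * t * ln q)"
    unfolding legendre_square
  proof (rule cInf_eq_minimum)
    show "exp (2 * t - f p - 2 * t * ln q)
        \<in> (\<lambda>y. dual_legendre u (y\<^sup>2) / y powr (2 * t)) ` {0<..}"
      using q(1) by (intro image_eqI[where x = q]) (auto simp: dual_q powr_def exp_diff)
    fix v assume "v \<in> (\<lambda>y. dual_legendre u (y\<^sup>2) / y powr (2 * t)) ` {0<..}"
    then obtain y where y: "y > 0" "v = dual_legendre u (y\<^sup>2) / y powr (2 * t)" by auto
    \<comment> \<open>Tangent-line bound for \<open>ln\<close> at \<open>1\<close>, evaluated at \<open>y / q\<close>.\<close>
    have "ln (y / q) \<le> y / q - 1" using y q by (intro ln_le_minus_one) auto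
    then have "t * (ln y - ln q) \<le> t * (y / q - 1)"
      using y q \<open>t > 0\<close> by (simp add: ln_div)
    also have "t * (y / q - 1) = p * y - t"
      using q p \<open>t > 0\<close> by (simp add: q_def field_simps)
    finally have "2 * t - f p - 2 * t * ln q \<le> 2 * p * y - f p - 2 * t * ln y"
      by (simp add: algebra_simps)
    then have "exp (2 * t - f p - 2 * t * ln q) \<le> exp (2 * p * y) / u (p\<^sup>2) / y powr (2 * t)"
      using y by (simp add: u_f powr_def flip: exp_diff)
    also have "\<dots> \<le> v"
      unfolding y(2) using y p by (intro divide_right_mono dual_legendre_lower[OF u]) auto
    finally show "exp (2 * t - f p - 2 * t * ln q) \<le> v" .
  qed
  also have "\<dots> = exp (2 * t) / (exp (f p - 2 * t * ln p) * exp (2 * t * ln t))"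
    using p \<open>t > 0\<close> by (simp add: q_def ln_div algebra_simps flip: exp_diff exp_add)
  also have "\<dots> = exp (2 * t) / (legendre u t * t powr (2 * t))"
    using \<open>t > 0\<close> by (simp add: val_u powr_def)
  finally show ?thesis .
qed

section \<open>The case of exponent zero\<close>

text \<open>With \<open>m = inf f\<close> and \<open>f x \<ge> 2 x - c\<close>, averaging these two lower bounds with weights \<open>1 - y\<close> and
  \<open>y\<close> gives \<open>2 x y - f x \<le> y c - (1 - y) m\<close> uniformly in \<open>x\<close>, which tends to \<open>- m\<close> as \<open>y \<rightarrow> 0\<close>. The
  reverse inequality is \<open>2 x y - f x \<ge> - f x\<close>.\<close>

lemma legendre_dual_zero:
  assumes u: "u \<in> C_half"
  shows "legendre (dual_legendre u) 0 = 1 / legendre u 0"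
proof -
  define L where "L = legendre u 0"
  have L_eq: "L = (INF x\<in>{0<..}. u (x\<^sup>2))"
    unfolding L_def legendre_square by (rule INF_cong) simp_all
  have dual_eq: "legendre (dual_legendre u) 0 = (INF y\<in>{0<..}. dual_legendre u (y\<^sup>2))"
    unfolding legendre_square by (rule INF_cong) simp_all
  have pos: "u (x\<^sup>2) > 0" for x using C_half_posD[OF u] by simp
  obtain c0 where c0: "\<And>x. x \<ge> 0 \<Longrightarrow> 0 * x - c0 \<le> ln (u (x\<^sup>2))"
    using ln_sq_superlinear[OF u] by blast
  have lower: "exp (- c0) \<le> u (x\<^sup>2)" if "x > 0" for x
    using c0[of x] that pos[of x] by (simp add: ln_ge_iff)
  have "exp (- c0) \<le> L"
    unfolding L_eq using lower by (intro cINF_greatest) auto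
  then have "L > 0" by (meson exp_gt_zero less_le_trans)
  have L_le: "L \<le> u (x\<^sup>2)" if "x > 0" for x
    unfolding L_eq using lower that by (intro cINF_lower bdd_belowI2[of _ "exp (- c0)"]) auto

  have dual_ge: "1 / L \<le> dual_legendre u (y\<^sup>2)" if "y > 0" for y
  proof -
    have inv: "1 / u (x\<^sup>2) \<le> dual_legendre u (y\<^sup>2)" if "x > 0" for x
    proof -
      have "1 / u (x\<^sup>2) \<le> exp (2 * x * y) / u (x\<^sup>2)"
        using pos[of x] that \<open>y > 0\<close> by (intro divide_right_mono) auto
      also have "\<dots> \<le> dual_legendre u (y\<^sup>2)"
        using that \<open>y > 0\<close> by (intro dual_legendre_lower[OF u]) auto
      finally show ?thesis .
    qed
    have "dual_legendre u (y\<^sup>2) > 0"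
      using inv[of 1] pos[of 1] by (auto intro: less_le_trans[rotated])
    moreover have "1 / dual_legendre u (y\<^sup>2) \<le> L"
      unfolding L_eq
      using inv pos calculation by (intro cINF_greatest) (auto simp: field_simps)
    ultimately show ?thesis using \<open>L > 0\<close> by (simp add: field_simps)
  qed

  obtain c where c: "\<And>x. x \<ge> 0 \<Longrightarrow> 2 * x - c \<le> ln (u (x\<^sup>2))"
    using ln_sq_superlinear[OF u] by blast
  have dual_le: "dual_legendre u (y\<^sup>2) \<le> exp (y * c - (1 - y) * ln L)" if "0 < y" "y < 1" for y
    unfolding dual_legendre_square[OF less_imp_le[OF \<open>0 < y\<close>]]
  proof (rule cSUP_least)
    fix x :: real assume "x \<in> {0<..}"
    then have x: "x > 0" by simp
    have "ln L \<le> ln (u (x\<^sup>2))" using L_le[OF x] \<open>L > 0\<close> pos[of x] by simp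
    then have "(1 - y) * ln L \<le> (1 - y) * ln (u (x\<^sup>2))" using that by (intro mult_left_mono) auto
    moreover have "y * (2 * x - c) \<le> y * ln (u (x\<^sup>2))"
      using that x c[of x] by (intro mult_left_mono) auto
    ultimately have "2 * x * y - ln (u (x\<^sup>2)) \<le> y * c - (1 - y) * ln L"
      by (simp add: algebra_simps)
    then show "exp (2 * x * y) / u (x\<^sup>2) \<le> exp (y * c - (1 - y) * ln L)"
      using pos[of x] by (simp add: exp_div_eq_exp_diff_ln)
  qed simp

  have "legendre (dual_legendre u) 0 \<le> 1 / L"
  proof (rule tendsto_lowerbound)
    have "((\<lambda>y. exp (y * c - (1 - y) * ln L)) \<longlongrightarrow> exp (0 * c - (1 - 0) * ln L)) (at_right 0)"
      by (intro tendsto_intros)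
    then show "((\<lambda>y. exp (y * c - (1 - y) * ln L)) \<longlongrightarrow> 1 / L) (at_right 0)"
      using \<open>L > 0\<close> by (simp add: exp_minus inverse_eq_divide)
    have "eventually (\<lambda>y::real. y \<in> {0<..<1}) (at_right 0)"
      by (rule eventually_at_right_real) simp
    then show "eventually (\<lambda>y. legendre (dual_legendre u) 0 \<le> exp (y * c - (1 - y) * ln L))
        (at_right 0)"
    proof (rule eventually_mono)
      fix y :: real assume y: "y \<in> {0<..<1}"
      then have "legendre (dual_legendre u) 0 \<le> dual_legendre u (y\<^sup>2)"
        unfolding dual_eq
        using dual_ge by (intro cINF_lower bdd_belowI2[of _ "1 / L"]) auto
      also have "\<dots> \<le> exp (y * c - (1 - y) * ln L)" using dual_le y by simp
      finally show "legendre (dual_legendre u) 0 \<le> exp (y * c - (1 - y) * ln L)" .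
    qed
  qed simp
  moreover have "1 / L \<le> legendre (dual_legendre u) 0"
    unfolding dual_eq using dual_ge by (intro cINF_greatest) auto
  ultimately show ?thesis by (simp add: L_def)
qed

section \<open>The Legendre transform of the dual\<close>

theorem theorem4p6:
  fixes u :: "real \<Rightarrow> real"
  assumes "u \<in> C_half" and "log_x2_convex u"
  shows "\<forall>t\<ge>0. legendre (dual_legendre u) t = exp (2 * t) / (legendre u t * rpow t (2 * t))"
proof (intro allI impI)
  fix t :: real assume "t \<ge> 0"
  then consider "t = 0" | "t > 0" by linarith
  then show "legendre (dual_legendre u) t = exp (2 * t) / (legendre u t * rpow t (2 * t))"
  proof cases
    case 1
    then show ?thesis using legendre_dual_zero[OF assms(1)] by (simp add: rpow_def)
  next
    case 2
    then show ?thesis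
      using legendre_dual_pos[OF assms(1)] assms(2) by (simp add: rpow_def log_x2_convex_def)
  qed
qed

end
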